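(* Let $X$ be a normed space, let $\{x_t\}_{t\in\mathbb{N}}$ be a sequence in $X$, let $\{\omega_t\}_{t\in\mathbb{N}}$ be a weighted sequence, and let $r\ge0$. If $\mathcal{I}$ is a maximal admissible ideal on $\mathbb{N}$, then $(\omega_t,\mathcal{I})\text{-}\Gamma_{x_t}^r$ is closed in $X$.
   Context: A sequence $\{\omega_t\}_{t\in\mathbb{N}}$ of real numbers is a weighted sequence if there is $\beta>0$ with $\omega_t>\beta$ for all $t\in\mathbb{N}$. An ideal on $\mathbb{N}$ is a family $\mathcal{I}\subseteq\mathcal{P}(\mathbb{N})$ with $\varnothing\in\mathcal{I}$, closed under finite unions and under taking subsets; it is non-trivial if $\mathbb{N}\notin\mathcal{I}$, and a non-trivial ideal is admissible if $\{t\}\in\mathcal{I}$ for each $t\in\mathbb{N}$. An ideal $\mathcal{I}$ is maximal if for any ideal $\mathcal{J}$ on $\mathbb{N}$ with $\mathcal{I}\subseteq\mathcal{J}\subseteq\mathcal{P}(\mathbb{N})$, either $\mathcal{J}=\mathcal{I}$ or $\mathcal{J}=\mathcal{P}(\mathbb{N})$. For a non-trivial ideal $\mathcal{I}$ and $r\ge0$, the rough weighted ideal cluster points set $(\omega_t,\mathcal{I})\text{-}\Gamma_{x_t}^r$ is the set of all $\gamma\in X$ such that $\{t\in\mathbb{N}:\omega_t\|x_t-\gamma\|<r+\varepsilon\}\notin\mathcal{I}$ for every $\varepsilon>0$. *)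

theory Defs
  imports Complex_Main
begin

definition weighted_seq :: "(nat \<Rightarrow> real) \<Rightarrow> bool" where
  "weighted_seq \<omega> \<longleftrightarrow> (\<exists>\<beta>>0. \<forall>t. \<omega> t > \<beta>)"

definition set_ideal :: "nat set set \<Rightarrow> bool" where
  "set_ideal I \<longleftrightarrow>
     {} \<in> I \<and>
     (\<forall>A\<in>I. \<forall>B\<in>I. A \<union> B \<in> I) \<and>
     (\<forall>A\<in>I. \<forall>B. B \<subseteq> A \<longrightarrow> B \<in> I)"

definition nontrivial_ideal :: "nat set set \<Rightarrow> bool" where
  "nontrivial_ideal I \<longleftrightarrow> set_ideal I \<and> UNIV \<notin> I"

definition admissible_ideal :: "nat set set \<Rightarrow> bool" where
  "admissible_ideal I \<longleftrightarrow> nontrivial_ideal I \<and> (\<forall>t. {t} \<in> I)"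

text \<open>The improper ideal \<open>UNIV\<close> (all of the power set) also satisfies this predicate;
  it is excluded by non-triviality, hence by admissibility.\<close>
definition maximal_ideal :: "nat set set \<Rightarrow> bool" where
  "maximal_ideal I \<longleftrightarrow>
     set_ideal I \<and> (\<forall>J. set_ideal J \<and> I \<subseteq> J \<longrightarrow> J = I \<or> J = UNIV)"

definition rough_weighted_cluster_points ::
  "(nat \<Rightarrow> real) \<Rightarrow> nat set set \<Rightarrow> real \<Rightarrow> (nat \<Rightarrow> 'a::real_normed_vector) \<Rightarrow> 'a set" where
  "rough_weighted_cluster_points \<omega> I r x =
     {\<gamma>. \<forall>\<epsilon>>0. {t. \<omega> t * norm (x t - \<gamma>) < r + \<epsilon>} \<notin> I}"

end

theory Submission
  imports Defs
begin

text \<open>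
  The complements of the members of a maximal admissible ideal form an ultrafilter, so a set lies
  outside \<open>I\<close> iff it is large for that ultrafilter; in particular two sets outside \<open>I\<close> meet in a set
  outside \<open>I\<close> (\<open>maximal_ideal_Int\<close>). This is the property that fails for general ideals, and
  everything else is the triangle inequality.

  There is a dichotomy. If the weights are bounded by a constant \<open>M\<close> on a set outside \<open>I\<close>, then
  moving \<open>\<gamma>\<close> by \<open>d\<close> changes \<open>\<omega> t * norm (x t - \<gamma>)\<close> by at most \<open>M * d\<close> on that set, so a limit of
  rough cluster points is a rough cluster point. If there is no such \<open>M\<close>, there is at most one
  rough cluster point: on the set outside \<open>I\<close> where \<open>x t\<close> is close to both of two distinct
  points \<open>a\<close> and \<open>b\<close> in the weighted sense, \<open>\<omega> t * norm (a - b)\<close> is less than \<open>2 * (r + 1)\<close>, and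
  this bounds the weights (\<open>distinct_cluster_points_bound_weights\<close>).
\<close>

lemma set_ideal_empty: "set_ideal I \<Longrightarrow> {} \<in> I"
  unfolding set_ideal_def by (elim conjE)

lemma set_ideal_Un: "set_ideal I \<Longrightarrow> A \<in> I \<Longrightarrow> B \<in> I \<Longrightarrow> A \<union> B \<in> I"
  unfolding set_ideal_def by (elim conjE) (drule (1) bspec)+

lemma set_ideal_subset: "set_ideal I \<Longrightarrow> A \<in> I \<Longrightarrow> B \<subseteq> A \<Longrightarrow> B \<in> I"
  unfolding set_ideal_def by (elim conjE) metis

lemma maximal_ideal_imp_set_ideal: "maximal_ideal I \<Longrightarrow> set_ideal I"
  by (simp add: maximal_ideal_def)

text \<open>
  Adjoining a set \<open>A\<close> to \<open>I\<close> generates the ideal of all subsets of the sets \<open>A \<union> C\<close> with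
  \<open>C \<in> I\<close>. If \<open>A \<notin> I\<close>, maximality makes this ideal improper, so some \<open>C \<in> I\<close> covers the
  complement of \<open>A\<close>.
\<close>
lemma maximal_ideal_Compl:
  assumes "maximal_ideal I" and "A \<notin> I"
  shows "- A \<in> I"
proof -
  have I: "set_ideal I"
    using assms(1) by (rule maximal_ideal_imp_set_ideal)
  define J where "J = {B. \<exists>C\<in>I. B \<subseteq> A \<union> C}"
  have "set_ideal J"
    unfolding set_ideal_def
  proof (intro conjI ballI allI impI)
    show "{} \<in> J"
      using set_ideal_empty[OF I] unfolding J_def by blast
  next
    fix B B' assume "B \<in> J" "B' \<in> J"
    then obtain C C' where C: "C \<in> I" "B \<subseteq> A \<union> C" and C': "C' \<in> I" "B' \<subseteq> A \<union> C'"
      unfolding J_def by blast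
    have "B \<union> B' \<subseteq> A \<union> (C \<union> C')"
      using C(2) C'(2) by blast
    then show "B \<union> B' \<in> J"
      using set_ideal_Un[OF I C(1) C'(1)] unfolding J_def by blast
  next
    fix B B' assume "B \<in> J" "B' \<subseteq> B"
    then show "B' \<in> J"
      unfolding J_def by blast
  qed
  moreover have "I \<subseteq> J"
    unfolding J_def by blast
  moreover have "A \<in> J"
    using set_ideal_empty[OF I] unfolding J_def by blast
  ultimately have "J = UNIV"
    using assms unfolding maximal_ideal_def by blast
  then obtain C where "C \<in> I" "UNIV \<subseteq> A \<union> C"
    unfolding J_def by blast
  then show ?thesis
    using set_ideal_subset[OF I, of C "- A"] by blast
qed

lemma maximal_ideal_Int:
  assumes "maximal_ideal I" and "UNIV \<notin> I" and "A \<notin> I" and "B \<notin> I"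
  shows "A \<inter> B \<notin> I"
proof
  assume "A \<inter> B \<in> I"
  moreover have "- A \<in> I" "- B \<in> I"
    using assms(1,3,4) by (simp_all add: maximal_ideal_Compl)
  ultimately have "(A \<inter> B) \<union> (- A \<union> - B) \<in> I"
    using maximal_ideal_imp_set_ideal[OF assms(1)] by (simp add: set_ideal_Un)
  moreover have "(A \<inter> B) \<union> (- A \<union> - B) = UNIV"
    by blast
  ultimately show False
    using assms(2) by simp
qed

lemma weighted_norm_triangle:
  fixes a b y :: "'a::real_normed_vector"
  assumes "w \<ge> 0"
  shows "w * norm (a - b) \<le> w * norm (a - y) + w * norm (y - b)"
proof -
  have "norm (a - b) \<le> norm (a - y) + norm (y - b)"
    using norm_triangle_ineq[of "a - y" "y - b"] by simp
  then show ?thesis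
    using mult_left_mono[OF _ assms] by (simp add: distrib_left[symmetric])
qed

lemma distinct_cluster_points_bound_weights:
  fixes x :: "nat \<Rightarrow> 'a::real_normed_vector"
  assumes "\<And>t. \<omega> t \<ge> 0" and "r \<ge> 0" and "maximal_ideal I" and "UNIV \<notin> I"
    and a: "a \<in> rough_weighted_cluster_points \<omega> I r x"
    and b: "b \<in> rough_weighted_cluster_points \<omega> I r x"
    and "a \<noteq> b"
  obtains M where "M > 0" and "{t. \<omega> t \<le> M} \<notin> I"
proof
  let ?M = "2 * (r + 1) / norm (a - b)"
  let ?S = "\<lambda>c. {t. \<omega> t * norm (x t - c) < r + 1}"
  show "?M > 0"
    using assms by simp
  have "?S a \<notin> I" "?S b \<notin> I"
    using a b unfolding rough_weighted_cluster_points_def by simp_all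
  then have "?S a \<inter> ?S b \<notin> I"
    by (rule maximal_ideal_Int[OF assms(3,4)])
  moreover have "?S a \<inter> ?S b \<subseteq> {t. \<omega> t \<le> ?M}"
  proof
    fix t assume "t \<in> ?S a \<inter> ?S b"
    then have "\<omega> t * norm (a - b) \<le> 2 * (r + 1)"
      using weighted_norm_triangle[OF assms(1), of t a b "x t"]
      by (simp add: norm_minus_commute)
    then show "t \<in> {t. \<omega> t \<le> ?M}"
      using \<open>a \<noteq> b\<close> by (simp add: pos_le_divide_eq)
  qed
  ultimately show "{t. \<omega> t \<le> ?M} \<notin> I"
    using set_ideal_subset[OF maximal_ideal_imp_set_ideal[OF assms(3)]] by blast
qed

text \<open>
  On the set where the weights are at most \<open>M\<close>, half of the tolerance \<open>\<epsilon>\<close> absorbs the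
  displacement of the centre; so a non-cluster point is surrounded by non-cluster points.
\<close>
lemma closed_cluster_points_if_weights_bounded:
  fixes x :: "nat \<Rightarrow> 'a::real_normed_vector"
  assumes "\<And>t. \<omega> t \<ge> 0" and "maximal_ideal I" and "UNIV \<notin> I"
    and M: "M > 0" "{t. \<omega> t \<le> M} \<notin> I"
  shows "closed (rough_weighted_cluster_points \<omega> I r x)" (is "closed ?G")
  unfolding closed_def open_dist
proof
  fix c assume "c \<in> - ?G"
  then obtain \<epsilon> where \<epsilon>: "\<epsilon> > 0" "{t. \<omega> t * norm (x t - c) < r + \<epsilon>} \<in> I"
    unfolding rough_weighted_cluster_points_def by auto
  have "y \<notin> ?G" if y: "dist y c < \<epsilon> / (2 * M)" for y
  proof
    let ?S = "{t. \<omega> t * norm (x t - y) < r + \<epsilon> / 2}"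
    assume "y \<in> ?G"
    then have "?S \<notin> I"
      using \<epsilon>(1) by (simp add: rough_weighted_cluster_points_def)
    then have "?S \<inter> {t. \<omega> t \<le> M} \<notin> I"
      using M(2) by (rule maximal_ideal_Int[OF assms(2,3)])
    moreover have "?S \<inter> {t. \<omega> t \<le> M} \<subseteq> {t. \<omega> t * norm (x t - c) < r + \<epsilon>}"
    proof
      fix t assume t: "t \<in> ?S \<inter> {t. \<omega> t \<le> M}"
      have "\<omega> t * norm (y - c) \<le> M * norm (y - c)"
        using t by (simp add: mult_right_mono)
      also have "\<dots> < \<epsilon> / 2"
        using y M(1) by (simp add: dist_norm field_simps)
      finally show "t \<in> {t. \<omega> t * norm (x t - c) < r + \<epsilon>}"
        using t weighted_norm_triangle[OF assms(1), of t "x t" c y] by simp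
    qed
    ultimately show False
      using \<epsilon>(2) set_ideal_subset[OF maximal_ideal_imp_set_ideal[OF assms(2)]] by blast
  qed
  then show "\<exists>e>0. \<forall>y. dist y c < e \<longrightarrow> y \<in> - ?G"
    using \<epsilon>(1) M(1) by (intro exI[of _ "\<epsilon> / (2 * M)"]) simp
qed

theorem proposition4p7:
  fixes x :: "nat \<Rightarrow> 'a::real_normed_vector"
    and \<omega> :: "nat \<Rightarrow> real"
    and r :: real
    and I :: "nat set set"
  assumes "weighted_seq \<omega>"
    and "r \<ge> 0"
    and "admissible_ideal I"
    and "maximal_ideal I"
  shows "closed (rough_weighted_cluster_points \<omega> I r x)"
proof -
  let ?G = "rough_weighted_cluster_points \<omega> I r x"
  have \<omega>: "\<omega> t \<ge> 0" for t
    using assms(1) unfolding weighted_seq_def by (meson less_imp_le less_trans)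
  have UNIV: "UNIV \<notin> I"
    using assms(3) by (simp add: admissible_ideal_def nontrivial_ideal_def)
  show ?thesis
  proof (cases "\<exists>a\<in>?G. \<exists>b\<in>?G. a \<noteq> b")
    case True
    then obtain a b where "a \<in> ?G" "b \<in> ?G" "a \<noteq> b"
      by blast
    then obtain M where "M > 0" "{t. \<omega> t \<le> M} \<notin> I"
      by (rule distinct_cluster_points_bound_weights[OF \<omega> assms(2,4) UNIV])
    then show ?thesis
      by (rule closed_cluster_points_if_weights_bounded[OF \<omega> assms(4) UNIV])
  next
    case False
    then have "?G = {} \<or> (\<exists>a. ?G = {a})"
      by blast
    then show ?thesis
      by auto
  qed
qed

end
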